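(* Let $G$ be a 2-connected bidirected cubic graph and let $\phi:E(G)\to\mathbb{Z}_3$ be a flow. Then there exists a $4$-flow $\psi:E(G)\to\mathbb{Z}$ satisfying $\psi(e)+3\mathbb{Z}=\phi(e)$ for every $e\in E(G)$.
   Context: $\mathbb{Z}_3=\mathbb{Z}/3\mathbb{Z}$. A signed graph is a graph $G$ together with a signature $\sigma:E(G)\to\{-1,1\}$. Every edge $e$ with ends $v,v'$ is regarded as composed of two half-edges, one incident with $v$ and one incident with $v'$; $H(G)$ is the set of half-edges, $H_v$ is the set of half-edges incident with $v$, and $e_h$ is the edge containing the half-edge $h$. An orientation of a signed graph is a function $\tau:H(G)\to\{-1,1\}$ such that every edge $e$ composed of half-edges $h,h'$ satisfies $\tau(h)\tau(h')=-\sigma(e)$. A bidirected graph is a signed graph equipped with an orientation. For a bidirected graph $G$, an abelian group $A$ and $\phi:E(G)\to A$, the boundary is $\partial\phi(v)=\sum_{h\in H_v}\tau(h)\phi(e_h)$ for $v\in V(G)$. The function $\phi$ is a flow (an $A$-flow) if $\partial\phi$ is identically $0$. For a positive integer $k$, a $k$-flow is a $\mathbb{Z}$-flow $\phi$ with $\phi(E(G))\subseteq\{-(k-1),\dots,k-1\}$. Flows are not required to be nowhere-zero. *)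

theory Defs
  imports Main "HOL-Library.Numeral_Type"
begin

text \<open>
  Finite undirected graphs presented by half-edges; loops and parallel edges are allowed.
  The map \<open>inc\<close> sends a half-edge to the vertex it is incident with, and \<open>edge_of\<close> sends it to
  the edge containing it.
\<close>

record ('v, 'e, 'h) half_edge_graph =
  verts :: "'v set"
  edges :: "'e set"
  halfs :: "'h set"
  inc :: "'h \<Rightarrow> 'v"
  edge_of :: "'h \<Rightarrow> 'e"

definition halfs_at :: "('v, 'e, 'h) half_edge_graph \<Rightarrow> 'v \<Rightarrow> 'h set" where
  "halfs_at G v = {h \<in> halfs G. inc G h = v}"

definition halfs_of :: "('v, 'e, 'h) half_edge_graph \<Rightarrow> 'e \<Rightarrow> 'h set" where
  "halfs_of G e = {h \<in> halfs G. edge_of G h = e}"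

locale graph =
  fixes G :: "('v, 'e, 'h) half_edge_graph"
  assumes finite_verts: "finite (verts G)"
    and finite_halfs: "finite (halfs G)"
    and inc_in_verts: "h \<in> halfs G \<Longrightarrow> inc G h \<in> verts G"
    and edge_of_in_edges: "h \<in> halfs G \<Longrightarrow> edge_of G h \<in> edges G"
    and two_halfs: "e \<in> edges G \<Longrightarrow> card (halfs_of G e) = 2"

locale signed_graph = graph G
  for G :: "('v, 'e, 'h) half_edge_graph" +
  fixes \<sigma> :: "'e \<Rightarrow> int"
  assumes signature: "e \<in> edges G \<Longrightarrow> \<sigma> e \<in> {-1, 1}"

locale bidirected_graph = signed_graph G \<sigma>
  for G :: "('v, 'e, 'h) half_edge_graph" and \<sigma> :: "'e \<Rightarrow> int" +
  fixes \<tau> :: "'h \<Rightarrow> int"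
  assumes orientation_sign: "h \<in> halfs G \<Longrightarrow> \<tau> h \<in> {-1, 1}"
    and orientation: "e \<in> edges G \<Longrightarrow> halfs_of G e = {h, h'} \<Longrightarrow> h \<noteq> h' \<Longrightarrow> \<tau> h * \<tau> h' = - \<sigma> e"

text \<open>The degree counts half-edges, so a loop contributes 2.\<close>

definition cubic :: "('v, 'e, 'h) half_edge_graph \<Rightarrow> bool" where
  "cubic G \<longleftrightarrow> (\<forall>v \<in> verts G. card (halfs_at G v) = 3)"

definition adjacency :: "('v, 'e, 'h) half_edge_graph \<Rightarrow> 'v rel" where
  "adjacency G = {(inc G h, inc G h') | h h'.
     h \<in> halfs G \<and> h' \<in> halfs G \<and> h \<noteq> h' \<and> edge_of G h = edge_of G h'}"

definition connected :: "('v, 'e, 'h) half_edge_graph \<Rightarrow> bool" where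
  "connected G \<longleftrightarrow> verts G \<noteq> {} \<and> (\<forall>u \<in> verts G. \<forall>v \<in> verts G. (u, v) \<in> (adjacency G)\<^sup>*)"

definition delete_vertex :: "('v, 'e, 'h) half_edge_graph \<Rightarrow> 'v \<Rightarrow> ('v, 'e, 'h) half_edge_graph" where
  "delete_vertex G x =
     (let E = {e \<in> edges G. \<forall>h \<in> halfs_of G e. inc G h \<noteq> x}
      in \<lparr> verts = verts G - {x}, edges = E, halfs = {h \<in> halfs G. edge_of G h \<in> E},
           inc = inc G, edge_of = edge_of G \<rparr>)"

definition loopless :: "('v, 'e, 'h) half_edge_graph \<Rightarrow> bool" where
  "loopless G \<longleftrightarrow> (\<forall>e \<in> edges G. inj_on (inc G) (halfs_of G e))"

text \<open>
  The convention for 2-connectedness is the one for multigraphs, where a loop together with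
  anything else counts as a separation at its vertex, and where two vertices joined by parallel
  edges are admitted. The looplessness condition matters only on two vertices: in a larger cubic
  graph a loop forces a cut vertex.
\<close>

definition two_connected :: "('v, 'e, 'h) half_edge_graph \<Rightarrow> bool" where
  "two_connected G \<longleftrightarrow> card (verts G) \<ge> 2 \<and> loopless G \<and> connected G \<and>
     (\<forall>x \<in> verts G. connected (delete_vertex G x))"

text \<open>
  The product of a sign with an element of an arbitrary abelian group is written out, since a
  type in \<^class>\<open>ab_group_add\<close> need not have a multiplication.
\<close>

definition boundary ::
  "('v, 'e, 'h) half_edge_graph \<Rightarrow> ('h \<Rightarrow> int) \<Rightarrow> ('e \<Rightarrow> 'a::ab_group_add) \<Rightarrow> 'v \<Rightarrow> 'a" where
  "boundary G \<tau> \<phi> v =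
     (\<Sum>h \<in> halfs_at G v. if \<tau> h = 1 then \<phi> (edge_of G h) else - \<phi> (edge_of G h))"

definition flow ::
  "('v, 'e, 'h) half_edge_graph \<Rightarrow> ('h \<Rightarrow> int) \<Rightarrow> ('e \<Rightarrow> 'a::ab_group_add) \<Rightarrow> bool" where
  "flow G \<tau> \<phi> \<longleftrightarrow> (\<forall>v \<in> verts G. boundary G \<tau> \<phi> v = 0)"

definition k_flow ::
  "nat \<Rightarrow> ('v, 'e, 'h) half_edge_graph \<Rightarrow> ('h \<Rightarrow> int) \<Rightarrow> ('e \<Rightarrow> int) \<Rightarrow> bool" where
  "k_flow k G \<tau> \<psi> \<longleftrightarrow> k > 0 \<and> flow G \<tau> \<psi> \<and> \<psi> ` edges G \<subseteq> {-(int k - 1)..int k - 1}"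

text \<open>
  The type \<^typ>\<open>3\<close> is the ring of integers modulo 3, and \<^term>\<open>of_int :: int \<Rightarrow> 3\<close> is the
  residue class map.
\<close>

type_synonym Z3 = 3

end

theory Submission
  imports Defs
begin

text \<open>
  Reverse the edges on which \<open>\<phi>\<close> is \<open>-1\<close> and lift \<open>\<phi>\<close> to a function with values in \<open>{0, 1}\<close>. Its
  boundary is \<open>3\<close> or \<open>-3\<close> at a vertex meeting three edges of the support and \<open>0\<close> elsewhere. Subtracting
  \<open>3 * y\<close> yields the required flow if \<open>y\<close> has a third of this boundary, is \<open>0\<close> or \<open>1\<close> on the support and
  \<open>-1\<close>, \<open>0\<close> or \<open>1\<close> off it. Such a \<open>y\<close> comes from a perfect matching of an auxiliary cubic graph, in
  which every vertex meeting an edge outside the support is split into a positive and a negative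
  vertex and every edge outside the support is doubled: on the latter, \<open>y\<close> is the difference of the
  indicators of the two copies. The auxiliary graph is bridgeless because \<open>G\<close> is, so Petersen's
  theorem applies. Petersen's theorem is deduced from Tutte's, for which we follow Lovasz: in an
  edge-maximal graph without a perfect matching, the vertices that are not adjacent to all others
  induce a disjoint union of cliques.
\<close>

section \<open>Perfect matchings\<close>

text \<open>With matchings as fixed-point-free involutions, the alternating walk in the union of two
  of them is an iteration of \<open>g \<circ> f\<close>. Values outside \<open>V\<close> are
  unconstrained, so matchings can be extended by function update.\<close>

definition perfect_matching :: "('a \<times> 'a) set \<Rightarrow> 'a set \<Rightarrow> ('a \<Rightarrow> 'a) \<Rightarrow> bool" where
  "perfect_matching E V f \<longleftrightarrow> (\<forall>v\<in>V. f v \<in> V \<and> f (f v) = v \<and> f v \<noteq> v \<and> (v, f v) \<in> E)"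

lemma perfect_matchingD:
  assumes "perfect_matching E V f" "v \<in> V"
  shows "f v \<in> V" "f (f v) = v" "f v \<noteq> v" "(v, f v) \<in> E"
  using assms by (auto simp: perfect_matching_def)

lemma perfect_matching_insert_pair:
  assumes f: "perfect_matching E V f" and "x \<notin> V" "y \<notin> V" "x \<noteq> y" "(x, y) \<in> E" "(y, x) \<in> E"
  shows "perfect_matching E (insert x (insert y V)) (f(x := y, y := x))"
proof -
  have "f v \<noteq> x \<and> f v \<noteq> y \<and> v \<noteq> x \<and> v \<noteq> y" if "v \<in> V" for v
    using perfect_matchingD(1)[OF f that] that assms by metis
  then show ?thesis using perfect_matchingD[OF f] assms by (auto simp: perfect_matching_def)
qed

text \<open>Deleting a pair \<open>x\<close>, \<open>f x\<close> preserves the hypotheses. The lemma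
  serves for the half-edges inside a vertex set, which the edges pair up.\<close>

lemma even_card_involution:
  assumes "finite A" "\<And>x. x \<in> A \<Longrightarrow> f x \<in> A \<and> f (f x) = x \<and> f x \<noteq> x"
  shows "even (card A)"
  using assms
proof (induction "card A" arbitrary: A rule: less_induct)
  case less
  show ?case
  proof (cases "A = {}")
    case False
    then obtain x where x: "x \<in> A" by blast
    let ?B = "A - {x, f x}"
    have fx: "f x \<in> A" "f x \<noteq> x" using less.prems(2)[OF x] by auto
    have "A = insert x (insert (f x) ?B)" using x fx by auto
    then have "card A = card (insert x (insert (f x) ?B))" by (rule arg_cong)
    then have card: "card A = card ?B + 2" using less.prems(1) fx(2) by simp
    have "f y \<in> ?B \<and> f (f y) = y \<and> f y \<noteq> y" if "y \<in> ?B" for y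
    proof -
      have "f (f y) = y" "f (f x) = x" "f y \<in> A" "f y \<noteq> y"
        using less.prems(2)[of y] less.prems(2)[OF x] that by auto
      moreover have "f y \<noteq> x" "f y \<noteq> f x" using calculation that by auto
      ultimately show ?thesis by blast
    qed
    then have "even (card ?B)"
      using less.hyps[of ?B] less.prems(1) card by simp
    then show ?thesis using card by simp
  qed simp
qed

text \<open>Vertices of equal colour are paired off until at most one of each colour is left; the
  leftovers are paired with vertices of \<open>U\<close>, and the rest of \<open>U\<close>, even in
  number, is paired arbitrarily.\<close>

lemma colour_matching:
  assumes "finite W" "finite U" "W \<inter> U = {}" "finite C" "c ` W \<subseteq> C"
    and "card {k \<in> C. odd (card {x \<in> W. c x = k})} \<le> card U"
    and "even (card W + card U)"
  shows "\<exists>f. perfect_matching {(x, y). x \<in> U \<or> y \<in> U \<or> c x = c y} (W \<union> U) f"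
  using assms
proof (induction "card W + card U" arbitrary: W U rule: less_induct)
  case less
  let ?odd = "\<lambda>W. {k \<in> C. odd (card {x \<in> W. c x = k})}"
  let ?E = "\<lambda>U. {(x, y). x \<in> U \<or> y \<in> U \<or> c x = c y}"
  note prems = less.prems
  \<comment> \<open>Each case below removes one matched pair \<open>x\<close>, \<open>y\<close> and
    leaves the rest to the induction hypothesis.\<close>
  have step: ?case
    if W': "W' \<subseteq> W" and U': "U' \<subseteq> U" and xy: "W \<union> U = insert x (insert y (W' \<union> U'))"
      and new: "x \<notin> W' \<union> U'" "y \<notin> W' \<union> U'" "x \<noteq> y" and e: "(x, y) \<in> ?E U"
      and o: "card (?odd W') \<le> card U'" for W' U' x y
  proof -
    have fin: "finite W'" "finite U'" using W' U' prems finite_subset by auto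
    have "card (W \<union> U) = card (W' \<union> U') + 2" using xy new fin by simp
    moreover have "card (W \<union> U) = card W + card U" "card (W' \<union> U') = card W' + card U'"
      using prems W' U' fin by (auto intro!: card_Un_disjoint)
    ultimately have sum: "card W + card U = card W' + card U' + 2" by simp
    have "\<exists>f. perfect_matching (?E U') (W' \<union> U') f"
      by (rule less.hyps) (use sum prems W' U' fin o in auto)
    then obtain f where "perfect_matching (?E U') (W' \<union> U') f" by blast
    then have "perfect_matching (?E U) (W' \<union> U') f" using U' by (auto simp: perfect_matching_def)
    from perfect_matching_insert_pair[OF this, of x y] show ?thesis using xy new e by auto
  qed
  show ?case
  proof (cases "inj_on c W")
    case False
    then obtain x y where xy: "x \<in> W" "y \<in> W" "x \<noteq> y" "c x = c y" by (auto simp: inj_on_def)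
    \<comment> \<open>Two vertices of the same colour leave together, so no class changes
      parity.\<close>
    have "odd (card {z \<in> W - {x, y}. c z = k}) \<longleftrightarrow> odd (card {z \<in> W. c z = k})" for k
    proof (cases "k = c x")
      case True
      have "{z \<in> W. c z = k} = insert x (insert y {z \<in> W - {x, y}. c z = k})"
        using xy True by auto
      then show ?thesis using prems(1) xy by simp
    next
      case False
      then have "{z \<in> W - {x, y}. c z = k} = {z \<in> W. c z = k}" using xy by auto
      then show ?thesis by simp
    qed
    then have "?odd (W - {x, y}) = ?odd W" by auto
    then show ?thesis using prems xy by (intro step[of "W - {x, y}" U x y]) auto
  next
    case inj: True
    have single: "{x \<in> W. c x = c y} = {y}" if "y \<in> W" for y
      using inj that by (auto simp: inj_on_def)
    \<comment> \<open>With no repeated colour every class that occurs is a singleton, hence odd.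
      This bounds \<open>card W\<close> by \<open>card U\<close>.\<close>
    have "c ` W \<subseteq> ?odd W" using prems(5) single by auto
    then have "card (c ` W) \<le> card (?odd W)" using prems(4) by (intro card_mono) auto
    then have WU: "card W \<le> card U" using card_image[OF inj] prems(6) by simp
    show ?thesis
    proof (cases "W = {}")
      case False
      then obtain x where x: "x \<in> W" by blast
      then have "card W > 0" using prems(1) card_gt_0_iff by blast
      then obtain u where u: "u \<in> U" using WU by fastforce
      have "?odd (W - {x}) \<subseteq> c ` (W - {x})"
      proof
        fix k assume "k \<in> ?odd (W - {x})"
        then have "{z \<in> W - {x}. c z = k} \<noteq> {}" by (metis (mono_tags, lifting) card.empty even_zero mem_Collect_eq)
        then show "k \<in> c ` (W - {x})" by auto
      qed
      then have "card (?odd (W - {x})) \<le> card (W - {x})"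
        using prems(1) by (meson card_image_le card_mono finite_Diff finite_imageI le_trans)
      also have "\<dots> \<le> card (U - {u})" using WU x u prems by simp
      finally show ?thesis using prems x u by (intro step[of "W - {x}" "U - {u}" x u]) auto
    next
      case W: True
      show ?thesis
      proof (cases "U = {}")
        case True
        then show ?thesis using W by (auto simp: perfect_matching_def)
      next
        case False
        then obtain u where u: "u \<in> U" by blast
        have "U \<noteq> {u}" using prems(7) W by auto
        then obtain v where v: "v \<in> U" "v \<noteq> u" using u by blast
        show ?thesis using prems u v W by (intro step[of "{}" "U - {u, v}" u v]) auto
      qed
    qed
  qed
qed

section \<open>Alternating walks and the exchange argument\<close>

text \<open>
  The orbit of \<open>d\<close> under two fixed-point-free involutions is a cycle whose edges alternate
  between them, so its two colour classes are disjoint.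
\<close>

lemma alternating_orbit_bipartite:
  assumes f: "perfect_matching E V f" and g: "perfect_matching E' V g" and d: "d \<in> V"
  shows "((g \<circ> f) ^^ i) d \<noteq> f (((g \<circ> f) ^^ j) d)"
proof -
  let ?q = "\<lambda>i. ((g \<circ> f) ^^ i) d"
  have mem: "?q i \<in> V" for i
    using d by (induction i) (auto dest: perfect_matchingD(1)[OF f] perfect_matchingD(1)[OF g])
  have suc: "?q (Suc i) = g (f (?q i))" for i by simp
  have main: "?q i \<noteq> f (?q j)" if "j \<le> i" for i j
    using that
  proof (induction "i - j" arbitrary: i j rule: less_induct)
    case less
    show ?case
    proof
      assume eq: "?q i = f (?q j)"
      \<comment> \<open>Cancelling \<open>g\<close> and then \<open>f\<close> turns a coincidence at
        \<open>(i, j)\<close> into one at \<open>(i - 1, j + 1)\<close>; the process ends at a fixed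
        point of \<open>f\<close> (case 1) or of \<open>g\<close> (case 2).\<close>
      consider "i = j" | "i = Suc j" | i' where "i = Suc i'" "Suc j \<le> i'"
        using less.prems by (metis Suc_leI le_neq_implies_less not0_implies_Suc less_Suc_eq_le less_nat_zero_code zero_less_Suc)
      then show False
      proof cases
        case 1
        then show False using eq perfect_matchingD(3)[OF f mem] by metis
      next
        case 2
        then show False using eq suc perfect_matchingD(3)[OF g perfect_matchingD(1)[OF f mem]] by metis
      next
        case 3
        have "g (f (?q i')) = f (?q j)" using eq 3 suc by metis
        then have "f (?q i') = g (f (?q j))" using perfect_matchingD(2)[OF g perfect_matchingD(1)[OF f mem]] by metis
        then have "f (?q i') = ?q (Suc j)" by simp
        then have "?q i' = f (?q (Suc j))" using perfect_matchingD(2)[OF f mem] by metis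
        moreover have "i' - Suc j < i - j" using 3 by simp
        ultimately show False using less.hyps 3 by blast
      qed
    qed
  qed
  show ?thesis
  proof (cases "j \<le> i")
    case False
    then have "?q j \<noteq> f (?q i)" using main by simp
    then show ?thesis using perfect_matchingD(2)[OF f mem] by metis
  qed (rule main)
qed

lemma perfect_matching_If:
  assumes f: "perfect_matching E V f" and g: "perfect_matching E' V g" and "D \<subseteq> V"
    and "\<And>x. x \<in> D \<Longrightarrow> f x \<in> D \<and> (x, f x) \<in> E''"
    and "\<And>x. x \<in> V - D \<Longrightarrow> g x \<in> V - D \<and> (x, g x) \<in> E''"
  shows "perfect_matching E'' V (\<lambda>x. if x \<in> D then f x else g x)"
  unfolding perfect_matching_def using assms(3-) perfect_matchingD[OF f] perfect_matchingD[OF g] by (auto 0 3)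

text \<open>Walk from \<open>d\<close> alternately along \<open>f\<close> and \<open>g\<close>. If
  the walk avoids \<open>a\<close> and \<open>c\<close>, it is a cycle through the edge
  \<open>bd\<close>, and using \<open>f\<close> on it and \<open>g\<close> elsewhere avoids both
  added edges. Otherwise let \<open>e\<close> be the first of \<open>a\<close>, \<open>c\<close> on
  it: take \<open>f\<close> on the walk before \<open>e\<close>, the edge \<open>eb\<close>, and
  \<open>g\<close> on the remaining vertices.\<close>

lemma perfect_matching_exchange:
  assumes fin: "finite V" and sym: "sym E"
    and ab: "(a, b) \<in> E" and bc: "(b, c) \<in> E" and dist: "a \<noteq> b" "b \<noteq> c" "b \<noteq> d"
    and d: "d \<noteq> a" "d \<noteq> c" and mem: "a \<in> V" "b \<in> V" "c \<in> V" "d \<in> V"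
    and f: "perfect_matching (E \<union> {(a, c), (c, a)}) V f" and g: "perfect_matching (E \<union> {(b, d), (d, b)}) V g"
  shows "\<exists>h. perfect_matching E V h"
proof (cases "perfect_matching E V f \<or> perfect_matching E V g")
  case False
  \<comment> \<open>A matching that avoids its added edge would already be one in \<open>E\<close>,
    so \<open>f\<close> uses \<open>ac\<close> and \<open>g\<close> uses \<open>bd\<close>.\<close>
  have fa: "f a = c" "f c = a"
    using False perfect_matchingD[OF f] unfolding perfect_matching_def by (metis (no_types) Pair_inject Un_iff empty_iff insert_iff)+
  have gb: "g b = d" "g d = b"
    using False perfect_matchingD[OF g] unfolding perfect_matching_def by (metis (no_types) Pair_inject Un_iff empty_iff insert_iff)+
  let ?q = "\<lambda>i. ((g \<circ> f) ^^ i) d"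
  have q: "?q i \<in> V" for i
    using mem(4) by (induction i) (auto dest: perfect_matchingD(1)[OF f] perfect_matchingD(1)[OF g])
  have fq: "f (?q i) \<in> V" "f (f (?q i)) = ?q i" for i using perfect_matchingD[OF f q] by auto
  have suc: "?q (Suc i) = g (f (?q i))" for i by simp
  have gsuc: "g (?q (Suc i)) = f (?q i)" for i using perfect_matchingD(2)[OF g fq(1)] suc by metis
  have fE: "(x, f x) \<in> E" if "x \<in> V" "x \<noteq> a" "x \<noteq> c" for x
    using perfect_matchingD(4)[OF f that(1)] that by auto
  have gE: "(x, g x) \<in> E" if "x \<in> V" "x \<noteq> b" "x \<noteq> d" for x
    using perfect_matchingD(4)[OF g that(1)] that by auto
  show ?thesis
  proof (cases "\<exists>k. ?q k \<in> {a, c}")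
    case False
    define D where "D = range ?q \<union> range (\<lambda>i. f (?q i))"
    have inj: "inj_on (g \<circ> f) V"
      by (rule inj_on_inverseI[of _ "f \<circ> g"]) (use perfect_matchingD[OF f] perfect_matchingD[OF g] in simp)
    have "\<not> inj ?q" using fin q by (meson finite_subset image_subsetI infinite_UNIV_nat finite_imageD)
    then obtain i j where ij: "?q i = ?q j" "i < j"
      unfolding inj_def by (metis linorder_neqE_nat)
    \<comment> \<open>Finiteness gives a repetition in the orbit; injectivity of
      \<open>g \<circ> f\<close> moves it back to the starting point \<open>d\<close>, so the orbit
      closes up there.\<close>
    have shift: "?q n = ?q (n + m) \<Longrightarrow> d = ?q m" for n m
    proof (induction n)
      case (Suc n)
      have "(g \<circ> f) (?q n) = (g \<circ> f) (?q (n + m))" 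
        using Suc.prems by (metis add_Suc comp_apply funpow.simps(2))
      then have "?q n = ?q (n + m)" using inj q unfolding inj_on_def by blast
      then show ?case using Suc.IH by blast
    qed simp
    obtain m where m: "d = ?q (Suc m)"
      using shift[of i "j - i"] ij by (metis Suc_diff_Suc le_add_diff_inverse less_imp_le)
    have gq: "g (?q i) \<in> D" for i
    proof (cases i)
      case 0
      have "g d = f (?q m)" using gsuc[of m] m by metis
      then show ?thesis using 0 by (auto simp: D_def)
    next
      case (Suc j)
      then show ?thesis using gsuc[of j] by (auto simp: D_def)
    qed
    have Df: "f x \<in> D" if "x \<in> D" for x using that fq by (auto simp: D_def)
    have Dg: "g x \<in> D" if "x \<in> D" for x
      using that gq suc unfolding D_def by (metis (no_types, lifting) UnE UnI1 imageE rangeI)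
    have DV: "D \<subseteq> V" using q fq by (auto simp: D_def)
    have "?q 0 \<in> D" unfolding D_def by blast
    then have dD: "d \<in> D" by simp
    have bD: "b \<in> D" using Dg[OF dD] gb by simp
    have ac: "a \<notin> D" "c \<notin> D"
      using False fa fq(2) by (auto simp: D_def)
    have "perfect_matching E V (\<lambda>x. if x \<in> D then f x else g x)"
    proof (rule perfect_matching_If[OF f g DV])
      fix x assume "x \<in> D" then show "f x \<in> D \<and> (x, f x) \<in> E"
        using Df fE DV ac by blast
    next
      fix x assume x: "x \<in> V - D"
      then have "g x \<notin> D" using Dg perfect_matchingD(2)[OF g] by (metis DiffD1 DiffD2)
      then show "g x \<in> V - D \<and> (x, g x) \<in> E" using x perfect_matchingD(1)[OF g] gE dD bD by blast
    qed
    then show ?thesis by blast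
  next
    case True
    \<comment> \<open>As \<open>f\<close> exchanges \<open>a\<close> and \<open>c\<close>, looking
      at the points \<open>?q i\<close> is enough: if \<open>f (?q i)\<close> is one of the two, so
      is \<open>?q i\<close>.\<close>
    define k where "k = (LEAST k. ?q k \<in> {a, c})"
    have k: "?q k \<in> {a, c}" unfolding k_def using LeastI_ex[OF True] .
    have less: "?q i \<notin> {a, c}" if "i < k" for i
      using that not_less_Least unfolding k_def by blast
    define e where "e = ?q k"
    have e: "e \<in> {a, c}" "e \<in> V" "e \<noteq> b" "(e, b) \<in> E" "(b, e) \<in> E" "f e \<in> {a, c}"
      using k ab bc dist mem fa sym by (auto simp: e_def sym_def)
    define D where "D = ?q ` {..<k} \<union> (\<lambda>i. f (?q i)) ` {..<k}"
    have DV: "D \<subseteq> V" using q fq by (auto simp: D_def)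
    have ac: "a \<notin> D" "c \<notin> D"
      using less fa fq(2) by (auto simp: D_def) metis+
    have Df: "f x \<in> D" if "x \<in> D" for x using that fq by (auto simp: D_def)
    \<comment> \<open>Since \<open>g b = d\<close>, the walk can reach \<open>b\<close> at an even
      position only right after returning to \<open>d\<close> at an odd one, which bipartiteness
      forbids.\<close>
    have bq: "?q i \<noteq> b" for i
    proof (cases i)
      case (Suc j)
      show ?thesis
      proof
        assume "?q i = b"
        then have "f (?q j) = d" using gb gsuc Suc by metis
        then show False using alternating_orbit_bipartite[OF f g mem(4), of 0 j] by simp
      qed
    qed (use dist in simp)
    \<comment> \<open>Reaching \<open>b\<close> at an odd position would bring the walk back to
      \<open>d\<close> next, so it would be periodic and would have met \<open>a\<close> or
      \<open>c\<close> before index \<open>k\<close>.\<close>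
    have bfq: "f (?q i) \<noteq> b" if "i < k" for i
    proof
      assume "f (?q i) = b"
      then have "?q (Suc i) = d" using gb suc by metis
      moreover have "?q (m + n) = ((g \<circ> f) ^^ m) (?q n)" for m n by (simp add: funpow_add)
      ultimately have "?q ((k - Suc i) + Suc i) = ?q (k - Suc i)" by metis
      then have "?q (k - Suc i) \<in> {a, c}" using k that by simp
      then show False using less[of "k - Suc i"] that by simp
    qed
    have bD: "b \<notin> D" using bq bfq by (auto simp: D_def)
    have eD: "e \<notin> D" using e ac by auto
    \<comment> \<open>The involution \<open>g\<close> pairs \<open>d\<close> with \<open>b\<close>
      and \<open>e\<close> with the last point before it, so the walk with both ends is closed under
      \<open>g\<close>, and so is its complement.\<close>
    have Dg: "g x \<in> insert e (insert b D)" if "x \<in> insert e (insert b D)" for x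
    proof -
      have gq: "g (?q i) \<in> insert e (insert b D)" if "i \<le> k" for i
        using that gb gsuc by (cases i) (auto simp: D_def)
      have gfq: "g (f (?q i)) \<in> insert e (insert b D)" if "i < k" for i
      proof (cases "Suc i = k")
        case True
        then have "e = g (f (?q i))" using suc[of i] by (metis e_def)
        then show ?thesis by blast
      next
        case False
        then have "?q (Suc i) \<in> D" using that unfolding D_def by (intro UnI1 imageI) simp
        then show ?thesis unfolding suc by blast
      qed
      have dD: "d \<in> insert e (insert b D)" by (cases k) (force simp: D_def e_def)+
      consider "x = e" | "x = b" | i where "i < k" "x = ?q i" | i where "i < k" "x = f (?q i)"
        using \<open>x \<in> insert e (insert b D)\<close> by (auto simp: D_def)
      then show ?thesis
      proof cases
        case 1
        then show ?thesis using gq[of k] e_def by simp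
      next
        case 2
        then show ?thesis using gb dD by metis
      next
        case 3
        then show ?thesis using gq[of i] by (metis less_imp_le)
      next
        case 4
        then show ?thesis using gfq[of i] by metis
      qed
    qed
    have dD: "d \<in> insert e D" by (cases k) (force simp: D_def e_def)+
    let ?V = "V - {e, b}"
    let ?h = "\<lambda>x. if x \<in> D then f x else g x"
    have "perfect_matching E ?V ?h"
      unfolding perfect_matching_def
    proof (intro ballI)
      fix x assume x: "x \<in> ?V"
      show "?h x \<in> ?V \<and> ?h (?h x) = x \<and> ?h x \<noteq> x \<and> (x, ?h x) \<in> E"
      proof (cases "x \<in> D")
        case True
        then have "f x \<in> D" "(x, f x) \<in> E" using Df fE x ac by auto
        then show ?thesis using True x perfect_matchingD[OF f, of x] bD eD by auto
      next
        case False
        then have "x \<notin> insert e (insert b D)" using x by auto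
        then have "g x \<notin> insert e (insert b D)" using Dg perfect_matchingD(2)[OF g] x by (metis DiffD1)
        moreover have "(x, g x) \<in> E" using gE x dD False by auto
        ultimately show ?thesis using False x perfect_matchingD[OF g, of x] by auto
      qed
    qed
    from perfect_matching_insert_pair[OF this, of e b] e
    have "perfect_matching E (insert e (insert b ?V)) (?h(e := b, b := e))" by blast
    moreover have "insert e (insert b ?V) = V" using e mem by auto
    ultimately show ?thesis by metis
  qed
qed blast

section \<open>Tutte's theorem\<close>

text \<open>Components of the graph minus \<open>U\<close> are expressed by a colouring that is
  constant along edges. Colours are vertex sets because the clique containing a vertex serves as its
  colour.\<close>

theorem tutte:
  fixes V :: "'a set"
  assumes fin: "finite V" and sym: "sym E" and no: "\<nexists>f. perfect_matching E V f"
  obtains U c where "U \<subseteq> V"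
    and "\<And>x y. x \<in> V - U \<Longrightarrow> y \<in> V - U \<Longrightarrow> (x, y) \<in> E \<Longrightarrow> c x = (c y :: 'a set)"
    and "card U < card {k \<in> c ` (V - U). odd (card {x \<in> V - U. c x = k})}"
proof (cases "even (card V)")
  case False
  \<comment> \<open>For an odd number of vertices, empty \<open>U\<close> and a single colour give
    one odd class against zero.\<close>
  have "{k \<in> (\<lambda>_::'a. {}::'a set) ` (V - {}). odd (card {x \<in> V - {}. {} = k})} = {{}}"
    using False by (auto simp: image_iff) (metis card.empty even_zero ex_in_conv)
  then show ?thesis by (intro that[of "{}" "\<lambda>_. {}"]) auto
next
  case True
  \<comment> \<open>Lovasz's saturation: \<open>F\<close> below is a maximal edge set on
    \<open>V\<close> that contains the edges of \<open>E\<close> in \<open>V\<close> and has no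
    perfect matching.\<close>
  define P where "P = {F. F \<subseteq> V \<times> V \<and> sym F \<and> E \<inter> V \<times> V \<subseteq> F \<and> (\<nexists>f. perfect_matching F V f)}"
  have "finite P" using fin by (intro finite_subset[of P "Pow (V \<times> V)"]) (auto simp: P_def)
  moreover have "E \<inter> V \<times> V \<in> P" using no sym by (auto simp: P_def sym_def perfect_matching_def)
  ultimately obtain F where F: "F \<in> P" and max: "\<And>F'. F' \<in> P \<Longrightarrow> F \<subseteq> F' \<Longrightarrow> F = F'"
    using finite_has_maximal2 by metis
  have FV: "F \<subseteq> V \<times> V" and symF: "sym F" and EF: "E \<inter> V \<times> V \<subseteq> F" and noF: "\<nexists>f. perfect_matching F V f"
    using F by (auto simp: P_def)
  have add: "\<exists>f. perfect_matching (F \<union> {(x, y), (y, x)}) V f" if "x \<in> V" "y \<in> V" "(x, y) \<notin> F" for x y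
  proof (rule ccontr)
    assume "\<not> ?thesis"
    then have "F \<union> {(x, y), (y, x)} \<in> P" using FV symF EF that by (auto simp: P_def sym_def)
    then show False using max that by blast
  qed
  define U where "U = {u \<in> V. \<forall>v\<in>V. v \<noteq> u \<longrightarrow> (u, v) \<in> F}"
  define c where "c = (\<lambda>x. {y \<in> V - U. y = x \<or> (x, y) \<in> F})"
  \<comment> \<open>If \<open>xz\<close> is missing, then \<open>y\<close>, not being universal, has
    a non-neighbour \<open>d\<close>. By maximality adding \<open>xz\<close> or adding
    \<open>yd\<close> creates a perfect matching, and the exchange lemma yields one in
    \<open>F\<close> itself.\<close>
  have trans: "(x, z) \<in> F" if "x \<in> V - U" "y \<in> V - U" "z \<in> V" "(x, y) \<in> F" "(y, z) \<in> F" "x \<noteq> z" for x y z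
  proof (rule ccontr)
    assume xz: "(x, z) \<notin> F"
    have "y \<in> V - U" by fact
    then obtain d where d: "d \<in> V" "d \<noteq> y" "(y, d) \<notin> F" by (auto simp: U_def)
    have mem: "x \<in> V" "y \<in> V" "z \<in> V" using that by auto
    obtain f where f: "perfect_matching (F \<union> {(x, z), (z, x)}) V f" using add[OF mem(1,3) xz] by blast
    obtain g where g: "perfect_matching (F \<union> {(y, d), (d, y)}) V g" using add[OF mem(2) d(1,3)] by blast
    have "\<exists>h. perfect_matching F V h"
    proof (rule perfect_matching_exchange[OF fin symF that(4,5) _ _ _ _ _ _ _ _ _ f g])
      show "d \<noteq> x" "d \<noteq> z" using that d symF by (auto simp: sym_def)
      show "x \<noteq> y" "y \<noteq> z" using that xz by auto
    qed (use that d in auto)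
    then show False using noF by blast
  qed
  have c_eq: "c x = c y" if "x \<in> V - U" "y \<in> V - U" "(x, y) \<in> F" for x y
    using that trans symF unfolding c_def sym_def by blast
  have U: "U \<subseteq> V" by (auto simp: U_def)
  show ?thesis
  proof (rule that[OF U, of c])
    show "c x = c y" if "x \<in> V - U" "y \<in> V - U" "(x, y) \<in> E" for x y
      using that EF c_eq by auto
    show "card U < card {k \<in> c ` (V - U). odd (card {x \<in> V - U. c x = k})}"
    proof (rule ccontr)
      assume le: "\<not> ?thesis"
      have "card V = card (V - U) + card U"
        using fin U by (metis card_Diff_subset card_mono finite_subset le_add_diff_inverse2)
      then have ev: "even (card (V - U) + card U)" using True by simp
      \<comment> \<open>With too few odd classes the greedy matching exists; its pairs lie in
        \<open>F\<close>, as members of \<open>U\<close> are universal and equally coloured vertices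
        are adjacent.\<close>
      have "\<exists>f. perfect_matching {(x, y). x \<in> U \<or> y \<in> U \<or> c x = c y} ((V - U) \<union> U) f"
        by (rule colour_matching[of _ _ "c ` (V - U)"]) (use le ev fin U finite_subset in auto)
      then obtain f where f: "perfect_matching {(x, y). x \<in> U \<or> y \<in> U \<or> c x = c y} V f"
        using U by (auto simp: Un_absorb2)
      have "(x, f x) \<in> F" if x: "x \<in> V" for x
      proof -
        note fx = perfect_matchingD[OF f x]
        consider "x \<in> U" | "f x \<in> U" | "x \<in> V - U" "f x \<in> V - U" "c x = c (f x)" using fx x by auto
        then show ?thesis
        proof cases
          case 1
          then show ?thesis using fx by (auto simp: U_def)
        next
          case 2
          then show ?thesis using fx x symF unfolding U_def sym_def by fastforce
        next
          case 3
          then have "f x \<in> c x" unfolding c_def by auto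
          then show ?thesis using fx by (auto simp: c_def)
        qed
      qed
      then have "perfect_matching F V f" using f by (auto simp: perfect_matching_def)
      then show False using noF by blast
    qed
  qed
qed

section \<open>Petersen's theorem for cubic multigraphs\<close>

text \<open>
  A cubic multigraph is given by its half-edges \<open>H\<close>, the incidence map \<open>i\<close>, and the involution
  \<open>p\<close> exchanging the two halves of each edge.
\<close>

theorem petersen:
  fixes H :: "'h set" and i :: "'h \<Rightarrow> 'v"
  assumes fin: "finite H"
    and p: "\<And>h. h \<in> H \<Longrightarrow> p h \<in> H \<and> p (p h) = h \<and> p h \<noteq> h"
    and cubic: "\<And>h. h \<in> H \<Longrightarrow> card {h' \<in> H. i h' = i h} = 3"
    and bridgeless: "\<And>X. card {h \<in> H. i h \<in> X \<and> i (p h) \<notin> X} \<noteq> 1"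
  obtains M where "M \<subseteq> H" "\<And>h. h \<in> M \<Longrightarrow> p h \<in> M"
    "\<And>v. v \<in> i ` H \<Longrightarrow> card {h \<in> M. i h = v} = 1"
proof -
  define V where "V = i ` H"
  define E where "E = {(i h, i (p h)) | h. h \<in> H}"
  have finV: "finite V" using fin by (simp add: V_def)
  have symE: "sym E"
  proof (rule symI)
    fix x y assume "(x, y) \<in> E"
    then obtain h where "h \<in> H" "x = i h" "y = i (p h)" by (auto simp: E_def)
    then show "(y, x) \<in> E" unfolding E_def using p[of h] by (auto intro!: exI[of _ "p h"])
  qed
  have deg: "card {h \<in> H. i h \<in> X} = 3 * card X" if "X \<subseteq> V" for X
  proof -
    have finX: "finite X" using that finV finite_subset by blast
    have "card (\<Union>v\<in>X. {h \<in> H. i h = v}) = (\<Sum>v\<in>X. card {h \<in> H. i h = v})"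
      using finX fin by (intro card_UN_disjoint) auto
    also have "\<dots> = (\<Sum>v\<in>X. 3)" using that cubic by (intro sum.cong) (auto simp: V_def)
    also have "(\<Union>v\<in>X. {h \<in> H. i h = v}) = {h \<in> H. i h \<in> X}" by auto
    finally show ?thesis by simp
  qed
  have "\<exists>f. perfect_matching E V f"
  proof (rule ccontr)
    assume no: "\<nexists>f. perfect_matching E V f"
    obtain U c where U: "U \<subseteq> V"
      and c: "\<And>x y. x \<in> V - U \<Longrightarrow> y \<in> V - U \<Longrightarrow> (x, y) \<in> E \<Longrightarrow> c x = (c y :: 'v set)"
      and less: "card U < card {k \<in> c ` (V - U). odd (card {x \<in> V - U. c x = k})}"
      by (rule tutte[OF finV symE no]) blast
    define odds where "odds = {k \<in> c ` (V - U). odd (card {x \<in> V - U. c x = k})}"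
    define K where "K k = {x \<in> V - U. c x = k}" for k
    define \<delta> where "\<delta> k = {h \<in> H. i h \<in> K k \<and> i (p h) \<notin> K k}" for k
    \<comment> \<open>Three times the odd size of the class is an even number of inner half-edges
      plus the half-edges leaving, so the latter are odd in number; bridgelessness excludes
      one.\<close>
    have \<delta>3: "3 \<le> card (\<delta> k)" if "k \<in> odds" for k
    proof -
      let ?I = "{h \<in> H. i h \<in> K k \<and> i (p h) \<in> K k}"
      have "odd (card (K k))" using that by (simp add: odds_def K_def)
      moreover have "card {h \<in> H. i h \<in> K k} = 3 * card (K k)" by (rule deg) (auto simp: K_def)
      moreover have "card {h \<in> H. i h \<in> K k} = card (?I \<union> \<delta> k)"
        by (rule arg_cong[of _ _ card]) (auto simp: \<delta>_def)
      moreover have "card (?I \<union> \<delta> k) = card ?I + card (\<delta> k)"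
        using fin by (intro card_Un_disjoint) (auto simp: \<delta>_def)
      moreover have "even (card ?I)"
        using fin p by (intro even_card_involution[of _ p]) auto
      ultimately have "odd (card (\<delta> k))" by (simp only:) presburger
      moreover have "card (\<delta> k) \<noteq> 1" using bridgeless unfolding \<delta>_def .
      ultimately show ?thesis by presburger
    qed
    have finO: "finite odds" using finV by (simp add: odds_def)
    have \<delta>U: "i (p h) \<in> U" if "h \<in> \<delta> k" for h k
    proof (rule ccontr)
      assume "i (p h) \<notin> U"
      moreover have "p h \<in> H" "(i h, i (p h)) \<in> E" using that p by (auto simp: \<delta>_def E_def)
      moreover have "i h \<in> K k" "i (p h) \<notin> K k" using that by (auto simp: \<delta>_def)
      ultimately show False using c[of "i h" "i (p h)"] by (auto simp: K_def V_def)
    qed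
    \<comment> \<open>Double counting: each odd class sends at least three edges to
      \<open>U\<close>, while \<open>U\<close> has only \<open>3 * card U\<close>
      half-edges.\<close>
    have "3 * card odds = (\<Sum>k\<in>odds. 3)" by simp
    also have "\<dots> \<le> (\<Sum>k\<in>odds. card (\<delta> k))" using \<delta>3 by (rule sum_mono)
    also have "\<dots> = card (\<Union>k\<in>odds. \<delta> k)"
      using finO fin by (intro card_UN_disjoint[symmetric]) (auto simp: \<delta>_def K_def)
    also have "\<dots> = card (p ` (\<Union>k\<in>odds. \<delta> k))"
      by (rule card_image[symmetric], rule inj_on_inverseI[of _ p]) (use p in \<open>auto simp: \<delta>_def\<close>)
    also have "\<dots> \<le> card {h \<in> H. i h \<in> U}"
      using fin \<delta>U p by (intro card_mono) (auto simp: \<delta>_def)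
    also have "\<dots> = 3 * card U" using deg U by simp
    finally show False using less unfolding odds_def by simp
  qed
  then obtain f where f: "perfect_matching E V f" by blast
  have ex: "\<exists>h. h \<in> H \<and> {i h, i (p h)} = {v, f v}" if "v \<in> V" for v
    using perfect_matchingD(4)[OF f that] by (auto simp: E_def)
  \<comment> \<open>The choice depends only on the unordered pair, so \<open>v\<close> and
    \<open>f v\<close> select the same one among parallel edges.\<close>
  define r where "r A = (SOME h. h \<in> H \<and> {i h, i (p h)} = A)" for A
  have r: "r {v, f v} \<in> H" "{i (r {v, f v}), i (p (r {v, f v}))} = {v, f v}" if "v \<in> V" for v
    using someI_ex[OF ex[OF that]] unfolding r_def by auto
  define M where "M = (\<Union>v\<in>V. {r {v, f v}, p (r {v, f v})})"
  show ?thesis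
  proof (rule that[of M])
    show "M \<subseteq> H" using r p by (auto simp: M_def)
    show "p h \<in> M" if "h \<in> M" for h using that r p by (auto simp: M_def)
    fix v assume "v \<in> i ` H"
    then have v: "v \<in> V" by (simp add: V_def)
    define t where "t = r {v, f v}"
    have ne: "f v \<noteq> v" using perfect_matchingD[OF f v] by simp
    have eq: "h \<in> {t, p t}" if "h \<in> M" "i h = v" for h
    proof -
      obtain w where w: "w \<in> V" "h \<in> {r {w, f w}, p (r {w, f w})}" using \<open>h \<in> M\<close> by (auto simp: M_def)
      have "p (p (r {w, f w})) = r {w, f w}" using r(1)[OF w(1)] p by blast
      then have "v \<in> {w, f w}" using r(2)[OF w(1)] w(2) \<open>i h = v\<close> by auto
      then have "{w, f w} = {v, f v}" using perfect_matchingD[OF f w(1)] by auto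
      then show ?thesis using w(2) by (simp add: t_def)
    qed
    have in_M: "t \<in> M" "p t \<in> M" using v by (auto simp: M_def t_def)
    consider "i t = v" "i (p t) = f v" | "i t = f v" "i (p t) = v"
      using r(2)[OF v] by (auto simp: t_def doubleton_eq_iff)
    then have "\<exists>h0. {h \<in> M. i h = v} = {h0}"
    proof cases
      case 1
      then have "h = t" if "h \<in> M" "i h = v" for h using eq[OF that] that ne by auto
      then have "{h \<in> M. i h = v} = {t}" using in_M \<open>i t = v\<close> by blast
      then show ?thesis by blast
    next
      case 2
      then have "h = p t" if "h \<in> M" "i h = v" for h using eq[OF that] that ne by auto
      then have "{h \<in> M. i h = v} = {p t}" using in_M \<open>i (p t) = v\<close> by blast
      then show ?thesis by blast
    qed
    then obtain h0 where "{h \<in> M. i h = v} = {h0}" by blast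
    then show "card {h \<in> M. i h = v} = 1" by simp
  qed
qed

section \<open>The signed cover\<close>

text \<open>
  The cover: half-edges carrying a unit of flow (\<open>supp\<close>) have one copy, the others two copies
  indexed by a sign, the sheet \<open>(v, s)\<close> of \<open>v\<close> receiving the copy with sign \<open>s * t h\<close>. A vertex
  whose three half-edges are in \<open>supp\<close> thus lies on one sheet only. A vertex with exactly one
  half-edge outside \<open>supp\<close> gets a rung, with half-edges \<open>Inr (v, 1)\<close> and \<open>Inr (v, -1)\<close>, between
  its two sheets.
\<close>

locale sign_cover =
  fixes H :: "'h set" and p :: "'h \<Rightarrow> 'h" and i :: "'h \<Rightarrow> 'v" and V :: "'v set"
    and supp :: "'h \<Rightarrow> bool" and t :: "'h \<Rightarrow> int"
  assumes finite_H: "finite H"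
    and finite_V: "finite V"
    and partner: "h \<in> H \<Longrightarrow> p h \<in> H \<and> p (p h) = h \<and> p h \<noteq> h"
    and i_in_V: "h \<in> H \<Longrightarrow> i h \<in> V"
    and no_loop: "h \<in> H \<Longrightarrow> i (p h) \<noteq> i h"
    and cubic: "v \<in> V \<Longrightarrow> card {h \<in> H. i h = v} = 3"
    and bridgeless: "W \<subseteq> V \<Longrightarrow> {h \<in> H. i h \<in> W \<and> i (p h) \<notin> W} \<subseteq> {h0} \<Longrightarrow> W = {} \<or> W = V"
    and supp_partner: "h \<in> H \<Longrightarrow> supp (p h) \<longleftrightarrow> supp h"
    and sign: "h \<in> H \<Longrightarrow> t h = 1 \<or> t h = -1"
    and balanced: "v \<in> V \<Longrightarrow> 3 dvd (\<Sum>h | h \<in> H \<and> i h = v. t h * of_bool (supp h))"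
begin

definition rungs :: "'v set" where
  "rungs = {v \<in> V. card {h \<in> H. i h = v \<and> \<not> supp h} = 1}"

definition cover_halfs :: "('h \<times> int + 'v \<times> int) set" where
  "cover_halfs = Inl ` {(h, s). h \<in> H \<and> (s = 1 \<or> s = -1 \<and> \<not> supp h)} \<union> Inr ` (rungs \<times> {1, -1})"

fun cover_inc :: "'h \<times> int + 'v \<times> int \<Rightarrow> 'v \<times> int" where
  "cover_inc (Inl (h, s)) = (i h, s * t h)"
| "cover_inc (Inr (v, s)) = (v, s)"

fun cover_partner :: "'h \<times> int + 'v \<times> int \<Rightarrow> 'h \<times> int + 'v \<times> int" where
  "cover_partner (Inl (h, s)) = Inl (p h, s)"
| "cover_partner (Inr (v, s)) = Inr (v, - s)"

lemma Inl_in_cover: "Inl (h, s) \<in> cover_halfs \<longleftrightarrow> h \<in> H \<and> (s = 1 \<or> s = -1 \<and> \<not> supp h)"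
  by (auto simp: cover_halfs_def)

lemma Inr_in_cover: "Inr (v, s) \<in> cover_halfs \<longleftrightarrow> v \<in> rungs \<and> (s = 1 \<or> s = -1)"
  by (auto simp: cover_halfs_def)

lemma finite_cover: "finite cover_halfs"
proof (rule finite_subset)
  show "cover_halfs \<subseteq> Inl ` (H \<times> {1, -1}) \<union> Inr ` (V \<times> {1, -1})" by (auto simp: cover_halfs_def rungs_def)
qed (use finite_H finite_V in auto)

lemma cover_partner: "k \<in> cover_halfs \<Longrightarrow> cover_partner k \<in> cover_halfs \<and> cover_partner (cover_partner k) = k \<and> cover_partner k \<noteq> k"
  using partner supp_partner by (cases k rule: cover_partner.cases) (auto simp: Inl_in_cover Inr_in_cover)

lemma sign_square: "h \<in> H \<Longrightarrow> t h * t h = 1"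
  using sign by fastforce

section \<open>Degrees in the cover\<close>

text \<open>As \<open>t h\<close> is its own inverse, the copy of \<open>h\<close> lying over the
  sheet \<open>(v, s)\<close> is the one with sign \<open>s * t h\<close>.\<close>

lemma card_fibre:
  assumes M: "M \<subseteq> cover_halfs" and s: "s = 1 \<or> s = -1"
  shows "card {k \<in> M. cover_inc k = (v, s)} =
    card {h \<in> H. i h = v \<and> Inl (h, s * t h) \<in> M} + of_bool (Inr (v, s) \<in> M)"
proof -
  let ?A = "{h \<in> H. i h = v \<and> Inl (h, s * t h) \<in> M}"
  let ?B = "if Inr (v, s) \<in> M then {Inr (v, s)} else {} :: ('h \<times> int + 'v \<times> int) set"
  have "{k \<in> M. cover_inc k = (v, s)} = (\<lambda>h. Inl (h, s * t h)) ` ?A \<union> ?B"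
  proof (intro set_eqI iffI)
    fix k assume k: "k \<in> {k \<in> M. cover_inc k = (v, s)}"
    then show "k \<in> (\<lambda>h. Inl (h, s * t h)) ` ?A \<union> ?B"
    proof (cases k rule: cover_partner.cases)
      case (1 h s')
      then have h: "h \<in> H" "i h = v" "s = s' * t h" using k M Inl_in_cover by auto
      then have eq: "s * t h = s'" using sign_square[of h] by (simp add: mult.assoc)
      then have "h \<in> ?A" "k = Inl (h, s * t h)" using 1 k h(1,2) by auto
      then show ?thesis by blast
    qed auto
  next
    fix k assume "k \<in> (\<lambda>h. Inl (h, s * t h)) ` ?A \<union> ?B"
    then show "k \<in> {k \<in> M. cover_inc k = (v, s)}"
      using sign_square by (auto simp: mult.assoc split: if_splits)
  qed
  then have "card {k \<in> M. cover_inc k = (v, s)} = card ((\<lambda>h. Inl (h, s * t h)) ` ?A \<union> ?B)" by simp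
  also have "\<dots> = card ((\<lambda>h. Inl (h, s * t h) :: 'h \<times> int + 'v \<times> int) ` ?A) + card ?B"
    using finite_H by (intro card_Un_disjoint) auto
  also have "card ((\<lambda>h. Inl (h, s * t h) :: 'h \<times> int + 'v \<times> int) ` ?A) = card ?A"
    by (intro card_image inj_onI) auto
  finally show ?thesis by simp
qed

text \<open>A rung adds one to both sheets and cancels in the difference. The lemma is applied to
  the whole cover and to a perfect matching of it, so that their boundaries can be compared.\<close>

lemma sum_fibres:
  assumes M: "M \<subseteq> cover_halfs" "\<And>k. k \<in> M \<Longrightarrow> cover_partner k \<in> M"
  shows "(\<Sum>h | h \<in> H \<and> i h = v. t h * (of_bool (Inl (h, 1) \<in> M) - of_bool (Inl (h, -1) \<in> M))) =
    int (card {k \<in> M. cover_inc k = (v, 1)}) - int (card {k \<in> M. cover_inc k = (v, -1)})"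
proof -
  have sum: "(\<Sum>h | h \<in> H \<and> i h = v. of_bool (Inl (h, s * t h) \<in> M)) =
      int (card {h \<in> H. i h = v \<and> Inl (h, s * t h) \<in> M})" for s
  proof -
    have "{h \<in> H. i h = v \<and> Inl (h, s * t h) \<in> M} =
        {h. h \<in> H \<and> i h = v} \<inter> {h. Inl (h, s * t h) \<in> M}" by auto
    then show ?thesis using finite_H by (simp add: sum.inter_restrict[symmetric] of_bool_def sum.If_cases)
  qed
  have "Inr (v, 1) \<in> M \<longleftrightarrow> Inr (v, -1) \<in> M" using M(2)[of "Inr (v, 1)"] M(2)[of "Inr (v, -1)"] by auto
  then have "int (card {k \<in> M. cover_inc k = (v, 1)}) - int (card {k \<in> M. cover_inc k = (v, -1)}) =
      (\<Sum>h | h \<in> H \<and> i h = v. of_bool (Inl (h, 1 * t h) \<in> M)) -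
      (\<Sum>h | h \<in> H \<and> i h = v. of_bool (Inl (h, (-1) * t h) \<in> M))"
    unfolding sum using card_fibre[OF M(1), of 1] card_fibre[OF M(1), of "-1"] by simp
  also have "\<dots> = (\<Sum>h | h \<in> H \<and> i h = v.
      t h * (of_bool (Inl (h, 1) \<in> M) - of_bool (Inl (h, -1) \<in> M)))"
    unfolding sum_subtractf[symmetric]
  proof (intro sum.cong refl)
    fix h assume "h \<in> {h. h \<in> H \<and> i h = v}"
    then have "t h = 1 \<or> t h = -1" using sign by blast
    then show "of_bool (Inl (h, 1 * t h) \<in> M) - of_bool (Inl (h, - 1 * t h) \<in> M) =
        t h * (of_bool (Inl (h, 1) \<in> M) - of_bool (Inl (h, - 1) \<in> M))" by auto
  qed
  finally show ?thesis by simp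
qed

definition n_out :: "'v \<Rightarrow> int \<Rightarrow> nat" where
  "n_out v s = card {h \<in> H. i h = v \<and> supp h \<and> t h = s}"

definition n_zero :: "'v \<Rightarrow> nat" where
  "n_zero v = card {h \<in> H. i h = v \<and> \<not> supp h}"

lemma card_fibre_cover:
  assumes s: "s = 1 \<or> s = -1" and v: "v \<in> V"
  shows "card {k \<in> cover_halfs. cover_inc k = (v, s)} = n_out v s + n_zero v + of_bool (n_zero v = 1)"
proof -
  have "h \<in> H \<Longrightarrow> Inl (h, s * t h) \<in> cover_halfs \<longleftrightarrow> \<not> supp h \<or> t h = s" for h
    using sign[of h] s by (auto simp: Inl_in_cover)
  then have "{h \<in> H. i h = v \<and> Inl (h, s * t h) \<in> cover_halfs} =
      {h \<in> H. i h = v \<and> supp h \<and> t h = s} \<union> {h \<in> H. i h = v \<and> \<not> supp h}" by auto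
  then have "card {h \<in> H. i h = v \<and> Inl (h, s * t h) \<in> cover_halfs} = n_out v s + n_zero v"
    unfolding n_out_def n_zero_def using finite_H by (simp add: card_Un_disjoint disjoint_iff)
  then show ?thesis
    using card_fibre[OF subset_refl s] v s by (simp add: Inr_in_cover rungs_def n_zero_def)
qed

text \<open>The three counts add up to 3, and by \<open>balanced\<close> the first two differ by a
  multiple of 3. In the mixed case \<open>(1, 1, 1)\<close> the rung raises both sheets to degree
  3.\<close>

lemma vertex_cases:
  assumes v: "v \<in> V"
  shows "(n_out v 1, n_out v (-1), n_zero v) \<in> {(3, 0, 0), (0, 3, 0), (1, 1, 1), (0, 0, 3)}"
proof -
  have "{h \<in> H. i h = v} = {h \<in> H. i h = v \<and> supp h \<and> t h = 1} \<union>
      ({h \<in> H. i h = v \<and> supp h \<and> t h = -1} \<union> {h \<in> H. i h = v \<and> \<not> supp h})"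
    using sign by auto
  also have "card \<dots> = n_out v 1 + (n_out v (-1) + n_zero v)"
    unfolding n_out_def n_zero_def using finite_H by (subst card_Un_disjoint; auto simp: card_Un_disjoint disjoint_iff)
  finally have three: "n_out v 1 + n_out v (-1) + n_zero v = 3" using cubic[OF v] by simp
  have "(\<Sum>h | h \<in> H \<and> i h = v. t h * of_bool (supp h)) =
      (\<Sum>h | h \<in> H \<and> i h = v. t h * (of_bool (Inl (h, 1) \<in> cover_halfs) - of_bool (Inl (h, -1) \<in> cover_halfs)))"
    by (intro sum.cong) (auto simp: Inl_in_cover)
  also have "\<dots> = int (n_out v 1) - int (n_out v (-1))"
    using sum_fibres[OF subset_refl] cover_partner card_fibre_cover v by simp
  finally have "3 dvd int (n_out v 1) - int (n_out v (-1))" using balanced[OF v] by simp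
  then obtain q where "int (n_out v 1) - int (n_out v (-1)) = 3 * q" by blast
  with three show ?thesis by simp presburger
qed

lemma card_fibre_cover_cases:
  assumes "s = 1 \<or> s = -1" "v \<in> V"
  shows "card {k \<in> cover_halfs. cover_inc k = (v, s)} \<in> {0, 3}"
  using vertex_cases[OF assms(2)] card_fibre_cover[OF assms] assms(1) by auto

lemma cover_inc_cover:
  assumes "k \<in> cover_halfs"
  shows "fst (cover_inc k) \<in> V" "snd (cover_inc k) = 1 \<or> snd (cover_inc k) = -1"
  using assms i_in_V sign by (cases k rule: cover_inc.cases; fastforce simp: Inl_in_cover Inr_in_cover rungs_def)+

lemma cover_cubic: "k \<in> cover_halfs \<Longrightarrow> card {k' \<in> cover_halfs. cover_inc k' = cover_inc k} = 3"
proof -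
  assume k: "k \<in> cover_halfs"
  then have "card {k' \<in> cover_halfs. cover_inc k' = cover_inc k} \<noteq> 0" using finite_cover by auto
  moreover have "card {k' \<in> cover_halfs. cover_inc k' = cover_inc k} \<in> {0, 3}"
    using card_fibre_cover_cases[OF cover_inc_cover(2)[OF k] cover_inc_cover(1)[OF k]] by simp
  ultimately show ?thesis by simp
qed

section \<open>Cuts of the cover\<close>

text \<open>Adapts \<open>bridgeless\<close> to a single edge when it is not known which of its
  halves leaves \<open>W\<close>.\<close>

lemma bridgeless_edge:
  assumes W: "W \<subseteq> V" and h0: "\<And>h. h \<in> H \<Longrightarrow> i h \<in> W \<Longrightarrow> i (p h) \<notin> W \<Longrightarrow> h = h0 \<or> h = p h0"
    and "h0 \<in> H"
  shows "W = {} \<or> W = V"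
proof (cases "i h0 \<in> W")
  case True
  then have "h = h0" if "h \<in> H" "i h \<in> W" "i (p h) \<notin> W" for h
    using h0[OF that] that partner[OF \<open>h0 \<in> H\<close>] by auto
  then have "{h \<in> H. i h \<in> W \<and> i (p h) \<notin> W} \<subseteq> {h0}" by blast
  then show ?thesis using bridgeless[OF W] by blast
next
  case False
  then have "h = p h0" if "h \<in> H" "i h \<in> W" "i (p h) \<notin> W" for h
    using h0[OF that] that by auto
  then have "{h \<in> H. i h \<in> W \<and> i (p h) \<notin> W} \<subseteq> {p h0}" by blast
  then show ?thesis using bridgeless[OF W] by blast
qed

text \<open>
  The vertices whose sheets a cut of the cover separates are joined to the others only by edges
  with two copies, exactly one of which is cut.
\<close>

lemma cover_bridgeless: "card {k \<in> cover_halfs. cover_inc k \<in> X \<and> cover_inc (cover_partner k) \<notin> X} \<noteq> 1"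
proof
  assume "card {k \<in> cover_halfs. cover_inc k \<in> X \<and> cover_inc (cover_partner k) \<notin> X} = 1"
  then obtain k0 where k0: "{k \<in> cover_halfs. cover_inc k \<in> X \<and> cover_inc (cover_partner k) \<notin> X} = {k0}" by (auto simp: card_1_singleton_iff)
  then have k0K: "k0 \<in> cover_halfs" "cover_inc k0 \<in> X" "cover_inc (cover_partner k0) \<notin> X" by auto
  have cut: "k = k0 \<or> k = cover_partner k0" if "k \<in> cover_halfs" "cover_inc k \<in> X \<longleftrightarrow> cover_inc (cover_partner k) \<notin> X" for k
  proof (cases "cover_inc k \<in> X")
    case True
    then show ?thesis using k0 that by blast
  next
    case False
    then have "cover_partner k \<in> {k \<in> cover_halfs. cover_inc k \<in> X \<and> cover_inc (cover_partner k) \<notin> X}" using that cover_partner[of k] by simp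
    then have "cover_partner k = k0" unfolding k0 by simp
    then show ?thesis using cover_partner[OF that(1)] by auto
  qed
  \<comment> \<open>Both sheets must occur in the cover: a vertex with a single sheet is never
    separated.\<close>
  define sep where "sep v \<longleftrightarrow> (v, 1) \<in> cover_inc ` cover_halfs \<and> (v, -1) \<in> cover_inc ` cover_halfs \<and> ((v, 1) \<in> X \<longleftrightarrow> (v, -1) \<notin> X)" for v
  define S where "S = {v \<in> V. sep v}"
  have SV: "S \<subseteq> V" by (auto simp: S_def)
  have ciK: "(i h, s * t h) \<in> cover_inc ` cover_halfs" if "Inl (h, s) \<in> cover_halfs" for h s
    using that by (metis cover_inc.simps(1) imageI)
  have unsep: "(v, s) \<in> X \<longleftrightarrow> (v, s') \<in> X" if "\<not> sep v" "(v, s) \<in> cover_inc ` cover_halfs" "(v, s') \<in> cover_inc ` cover_halfs" for v s s'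
  proof -
    have "r = 1 \<or> r = -1" if r: "(v, r) \<in> cover_inc ` cover_halfs" for r
    proof -
      obtain k where "k \<in> cover_halfs" "(v, r) = cover_inc k" using r by blast
      then show ?thesis using cover_inc_cover(2) by (metis snd_conv)
    qed
    then have "s = 1 \<or> s = -1" "s' = 1 \<or> s' = -1" using that(2,3) by blast+
    then show ?thesis using that unfolding sep_def by auto
  qed
  have sep_zero: "sep (i h) \<longleftrightarrow> ((i h, t h) \<in> X \<longleftrightarrow> (i h, - t h) \<notin> X)" if "h \<in> H" "\<not> supp h" for h
  proof -
    have "(i h, t h) \<in> cover_inc ` cover_halfs" "(i h, - t h) \<in> cover_inc ` cover_halfs"
      using ciK[of h 1] ciK[of h "-1"] that by (auto simp: Inl_in_cover)
    then show ?thesis using sign[OF that(1)] unfolding sep_def by auto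
  qed
  have cut_Inl: "Inl (h, s) = k0 \<or> Inl (h, s) = cover_partner k0"
    if "Inl (h, s) \<in> cover_halfs" "(i h, s * t h) \<in> X \<longleftrightarrow> (i (p h), s * t (p h)) \<notin> X" for h s
    using cut[OF that(1)] that(2) by simp
  \<comment> \<open>When exactly one end is separated, the four sheets are split unevenly by
    \<open>X\<close>, so one of the two copies is cut.\<close>
  have zero: "\<exists>s. Inl (h, s) = k0 \<or> Inl (h, s) = cover_partner k0"
    if "h \<in> H" "\<not> supp h" "sep (i h) \<longleftrightarrow> \<not> sep (i (p h))" for h
  proof -
    have "p h \<in> H" "\<not> supp (p h)" using that partner supp_partner by auto
    then have "((i h, t h) \<in> X \<longleftrightarrow> (i (p h), t (p h)) \<notin> X) \<or> ((i h, - t h) \<in> X \<longleftrightarrow> (i (p h), - t (p h)) \<notin> X)"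
      using sep_zero that by blast
    then show ?thesis using cut_Inl[of h 1] cut_Inl[of h "-1"] that by (auto simp: Inl_in_cover)
  qed
  \<comment> \<open>A separated vertex has two sheets; if it also meets the support it is of type
    \<open>(1, 1, 1)\<close>.\<close>
  have rung: "i h \<in> rungs" if "h \<in> H" "supp h" "sep (i h)" for h
  proof -
    have v: "i h \<in> V" using i_in_V that by blast
    have "card {k \<in> cover_halfs. cover_inc k = (i h, s)} \<noteq> 0" if "s = 1 \<or> s = -1" for s
    proof -
      have "(i h, s) \<in> cover_inc ` cover_halfs" using \<open>sep (i h)\<close> that unfolding sep_def by auto
      then have "{k \<in> cover_halfs. cover_inc k = (i h, s)} \<noteq> {}" by auto
      then show ?thesis using finite_cover by simp
    qed
    then have ne: "card {k \<in> cover_halfs. cover_inc k = (i h, 1)} \<noteq> 0" "card {k \<in> cover_halfs. cover_inc k = (i h, -1)} \<noteq> 0" by blast+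
    have "{h' \<in> H. i h' = i h \<and> supp h' \<and> t h' = t h} \<noteq> {}" using that by blast
    then have "n_out (i h) (t h) \<noteq> 0" using finite_H by (auto simp: n_out_def)
    then have "n_out (i h) 1 \<noteq> 0 \<or> n_out (i h) (-1) \<noteq> 0" using sign[OF that(1)] by auto
    then have "n_zero (i h) = 1"
      using vertex_cases[OF v] ne card_fibre_cover[OF _ v, of 1] card_fibre_cover[OF _ v, of "-1"] by auto
    then show ?thesis using v by (simp add: rungs_def n_zero_def)
  qed
  have sep_rung: "k0 = Inr (v, 1) \<or> k0 = Inr (v, -1)" if "v \<in> rungs" "sep v" for v
  proof -
    have "Inr (v, 1) = k0 \<or> Inr (v, 1) = cover_partner k0"
      using cut[of "Inr (v, 1)"] that by (auto simp: Inr_in_cover sep_def)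
    then show ?thesis using cover_partner[OF k0K(1)] cover_partner.simps(2)[of v 1] by metis
  qed
  show False
  proof (cases k0 rule: cover_partner.cases)
    case (1 h0 s0)
    have h0: "h0 \<in> H" "s0 = 1 \<or> s0 = -1 \<and> \<not> supp h0" using k0K(1) 1 by (auto simp: Inl_in_cover)
    have X0: "(i h0, s0 * t h0) \<in> X" "(i (p h0), s0 * t (p h0)) \<notin> X" using k0K 1 by auto
    have nosep: "\<not> sep (i h)" if "h \<in> H" "supp h" for h
      using rung[OF that] sep_rung[of "i h"] 1 by auto
    \<comment> \<open>No rung is cut, so separated vertices avoid the support and only the edge of
      \<open>h0\<close> can leave \<open>S\<close>.\<close>
    have "S = {} \<or> S = V"
    proof (rule bridgeless_edge[OF SV _ h0(1)])
      fix h assume h: "h \<in> H" "i h \<in> S" "i (p h) \<notin> S"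
      then have "sep (i h)" "\<not> sep (i (p h))" using i_in_V partner by (auto simp: S_def)
      then show "h = h0 \<or> h = p h0" using zero[of h] nosep[of h] h 1 by auto
    qed
    then have seps: "sep (i h) \<longleftrightarrow> sep (i h')" if "h \<in> H" "h' \<in> H" for h h'
      using i_in_V that by (auto simp: S_def)
    have p0: "p h0 \<in> H" "p (p h0) = h0" "supp (p h0) \<longleftrightarrow> supp h0" using partner supp_partner h0 by auto
    show False
    proof (cases "supp h0")
      case False
      \<comment> \<open>The ends of \<open>h0\<close> are both separated or both not, so cutting one
        copy cuts the other as well, contrary to uniqueness.\<close>
      have "(i h0, - s0 * t h0) \<in> X \<longleftrightarrow> (i (p h0), - s0 * t (p h0)) \<notin> X"
        using sep_zero[OF h0(1) False] sep_zero[OF p0(1)] p0(3) False seps[OF h0(1) p0(1)] X0 h0(2) by auto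
      then have "Inl (h0, - s0) = k0 \<or> Inl (h0, - s0) = cover_partner k0"
        using False h0 by (intro cut_Inl) (auto simp: Inl_in_cover)
      then show False using 1 h0(2) by auto
    next
      case True
      then have ns: "\<not> sep (i h)" if "h \<in> H" for h using nosep[OF h0(1)] seps[OF h0(1) that] by blast
      \<comment> \<open>With no vertex separated, \<open>X\<close> projects to the vertex set
        \<open>W\<close> of the base graph, where \<open>h0\<close> would be a bridge.\<close>
      define W where "W = {v \<in> V. \<exists>s. (v, s) \<in> cover_inc ` cover_halfs \<and> (v, s) \<in> X}"
      have W: "i h \<in> W \<longleftrightarrow> (i h, t h) \<in> X" if "h \<in> H" for h
      proof -
        have "(i h, t h) \<in> cover_inc ` cover_halfs" using ciK[of h 1] that by (simp add: Inl_in_cover)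
        then show ?thesis using unsep[OF ns[OF that]] i_in_V[OF that] unfolding W_def by blast
      qed
      have "W = {} \<or> W = V"
      proof (rule bridgeless_edge[OF _ _ h0(1)])
        fix h assume h: "h \<in> H" "i h \<in> W" "i (p h) \<notin> W"
        then have "Inl (h, 1) = k0 \<or> Inl (h, 1) = cover_partner k0"
          using W[of h] W[of "p h"] partner by (intro cut_Inl) (auto simp: Inl_in_cover)
        then show "h = h0 \<or> h = p h0" using 1 by auto
      qed (auto simp: W_def)
      moreover have "i h0 \<in> W" "i (p h0) \<notin> W" using W[OF h0(1)] W[OF p0(1)] X0 h0(2) True by auto
      ultimately show False using i_in_V[OF p0(1)] by auto
    qed
  next
    case (2 v0 s0)
    have v0: "v0 \<in> rungs" "s0 = 1 \<or> s0 = -1" "(v0, s0) \<in> X" "(v0, - s0) \<notin> X"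
      using k0K 2 by (auto simp: Inr_in_cover)
    then have v0V: "v0 \<in> V" by (auto simp: rungs_def)
    have "Inr (v0, 1) \<in> cover_halfs" "Inr (v0, -1) \<in> cover_halfs" using v0(1) by (auto simp: Inr_in_cover)
    then have "(v0, 1) \<in> cover_inc ` cover_halfs" "(v0, -1) \<in> cover_inc ` cover_halfs" by (metis cover_inc.simps(2) imageI)+
    then have sep0: "sep v0" using v0 by (auto simp: sep_def)
    obtain c where c: "{h \<in> H. i h = v0 \<and> \<not> supp h} = {c}"
      using v0(1) by (auto simp: rungs_def card_1_singleton_iff)
    then have cH: "c \<in> H" "i c = v0" "\<not> supp c" by auto
    have supp_sep: "i h = v0" if "h \<in> H" "supp h" "sep (i h)" for h
      using sep_rung[OF rung[OF that] that(3)] 2 by auto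
    have no_cut: "sep (i h) \<longleftrightarrow> sep (i (p h))" if "h \<in> H" "\<not> supp h" for h
      using zero[OF that] 2 by auto
    \<comment> \<open>The cut is the rung at \<open>v0\<close>, so only \<open>v0\<close> can be
      separated among vertices meeting the support. The other members of \<open>S\<close> can then
      leave only into \<open>v0\<close>, along its unique edge \<open>c\<close> outside the support.
      But the far end of \<open>c\<close> is separated too.\<close>
    have "S - {v0} = {} \<or> S - {v0} = V"
    proof (rule bridgeless)
      show "{h \<in> H. i h \<in> S - {v0} \<and> i (p h) \<notin> S - {v0}} \<subseteq> {p c}"
      proof
        fix h assume "h \<in> {h \<in> H. i h \<in> S - {v0} \<and> i (p h) \<notin> S - {v0}}"
        then have h: "h \<in> H" "sep (i h)" "i h \<noteq> v0" "i (p h) \<notin> S - {v0}" by (auto simp: S_def)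
        then have ns: "\<not> supp h" using supp_sep by blast
        then have "sep (i (p h))" using no_cut h by blast
        then have "i (p h) = v0" using h i_in_V partner by (auto simp: S_def)
        then have "p h \<in> {h \<in> H. i h = v0 \<and> \<not> supp h}" using h ns partner supp_partner by auto
        then have "p h = c" unfolding c by simp
        then show "h \<in> {p c}" using partner[OF h(1)] by auto
      qed
    qed (use SV in auto)
    then have "S \<subseteq> {v0}" using v0V by blast
    moreover have "i (p c) \<in> S" using no_cut[OF cH(1,3)] cH sep0 i_in_V partner by (auto simp: S_def)
    ultimately show False using no_loop[OF cH(1)] cH(2) by auto
  qed
qed

text \<open>The matching takes one of the three half-edges at every sheet. Comparing
  \<open>sum_fibres\<close> for the cover and for the matching therefore gives the factor 3; a
  support edge has only the positive copy, whence its values 0 and 1.\<close>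

lemma integral_correction:
  obtains y :: "'h \<Rightarrow> int" where "\<And>h. h \<in> H \<Longrightarrow> y (p h) = y h"
    and "\<And>h. h \<in> H \<Longrightarrow> y h \<in> (if supp h then {0, 1} else {-1, 0, 1})"
    and "\<And>v. v \<in> V \<Longrightarrow> (\<Sum>h | h \<in> H \<and> i h = v. t h * (of_bool (supp h) - 3 * y h)) = 0"
proof -
  obtain M where M: "M \<subseteq> cover_halfs" "\<And>k. k \<in> M \<Longrightarrow> cover_partner k \<in> M"
    "\<And>x. x \<in> cover_inc ` cover_halfs \<Longrightarrow> card {k \<in> M. cover_inc k = x} = 1"
    using petersen[OF finite_cover cover_partner cover_cubic cover_bridgeless] by blast
  define y :: "'h \<Rightarrow> int" where "y h = of_bool (Inl (h, 1) \<in> M) - of_bool (Inl (h, -1) \<in> M)" for h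
  have M_partner: "Inl (p h, s) \<in> M \<longleftrightarrow> Inl (h, s) \<in> M" if "h \<in> H" for h s
    using M(2)[of "Inl (h, s)"] M(2)[of "Inl (p h, s)"] partner[OF that] by auto
  show ?thesis
  proof (rule that[of y])
    show "y (p h) = y h" if "h \<in> H" for h using M_partner that by (simp add: y_def)
    show "y h \<in> (if supp h then {0, 1} else {-1, 0, 1})" if "h \<in> H" for h
      using M(1) Inl_in_cover[of h "-1"] by (auto simp: y_def)
    fix v assume v: "v \<in> V"
    \<comment> \<open>Sheets that do not occur must be included: there both sides are 0.\<close>
    have fibre: "card {k \<in> cover_halfs. cover_inc k = (v, s)} = 3 * card {k \<in> M. cover_inc k = (v, s)}" for s
    proof (cases "(v, s) \<in> cover_inc ` cover_halfs")
      case True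
      then obtain k where "k \<in> cover_halfs" "(v, s) = cover_inc k" by blast
      then show ?thesis using M(3)[OF True] cover_cubic by simp
    next
      case False
      then have "{k \<in> cover_halfs. cover_inc k = (v, s)} = {}" "{k \<in> M. cover_inc k = (v, s)} = {}" using M(1) by force+
      then show ?thesis by (simp only: card.empty mult_0_right)
    qed
    have "(\<Sum>h | h \<in> H \<and> i h = v. t h * of_bool (supp h)) =
        (\<Sum>h | h \<in> H \<and> i h = v. t h * (of_bool (Inl (h, 1) \<in> cover_halfs) - of_bool (Inl (h, -1) \<in> cover_halfs)))"
      by (intro sum.cong) (auto simp: Inl_in_cover)
    also have "\<dots> = 3 * (\<Sum>h | h \<in> H \<and> i h = v. t h * y h)"
      unfolding y_def using sum_fibres[OF subset_refl] sum_fibres[OF M(1,2)] cover_partner fibre by simp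
    finally show "(\<Sum>h | h \<in> H \<and> i h = v. t h * (of_bool (supp h) - 3 * y h)) = 0"
      by (simp add: sum_subtractf sum_distrib_left algebra_simps)
  qed
qed

end

section \<open>Flows modulo 3\<close>

definition partner :: "('v, 'e, 'h) half_edge_graph \<Rightarrow> 'h \<Rightarrow> 'h" where
  "partner G h = (THE h'. h' \<in> halfs G \<and> h' \<noteq> h \<and> edge_of G h' = edge_of G h)"

context graph
begin

lemma
  assumes h: "h \<in> halfs G"
  shows partner_in_halfs: "partner G h \<in> halfs G"
    and partner_neq: "partner G h \<noteq> h"
    and edge_of_partner: "edge_of G (partner G h) = edge_of G h"
    and partner_partner: "partner G (partner G h) = h"
    and halfs_of_edge_of: "halfs_of G (edge_of G h) = {h, partner G h}"
    and partner_unique: "h' \<in> halfs G \<Longrightarrow> h' \<noteq> h \<Longrightarrow> edge_of G h' = edge_of G h \<Longrightarrow> h' = partner G h"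
proof -
  have "card (halfs_of G (edge_of G h)) = 2" using two_halfs edge_of_in_edges h by blast
  moreover have "h \<in> halfs_of G (edge_of G h)" using h by (simp add: halfs_of_def)
  ultimately obtain k where k: "halfs_of G (edge_of G h) = {h, k}" "k \<noteq> h"
    unfolding card_2_iff by (metis insertE insert_commute singletonD)
  have k_iff: "h' = h \<or> h' = k \<longleftrightarrow> h' \<in> halfs G \<and> edge_of G h' = edge_of G h" for h'
    using k(1) unfolding halfs_of_def by blast
  have eq: "partner G h = k" unfolding partner_def using k(2) k_iff by (intro the_equality) metis+
  have "partner G k = h" unfolding partner_def using k(2) k_iff by (intro the_equality) metis+
  then show "partner G h \<in> halfs G" "partner G h \<noteq> h" "edge_of G (partner G h) = edge_of G h"
    "partner G (partner G h) = h" "halfs_of G (edge_of G h) = {h, partner G h}"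
    "h' \<in> halfs G \<Longrightarrow> h' \<noteq> h \<Longrightarrow> edge_of G h' = edge_of G h \<Longrightarrow> h' = partner G h"
    using k k_iff eq by metis+
qed

end

text \<open>A walk from \<open>x\<close> to \<open>y\<close> has to leave \<open>W\<close> at some
  step.\<close>

lemma connected_crossing:
  assumes "connected G" "x \<in> verts G" "x \<in> W" "y \<in> verts G" "y \<notin> W"
  obtains h h' where "h \<in> halfs G" "h' \<in> halfs G" "h \<noteq> h'" "edge_of G h = edge_of G h'"
    "inc G h \<in> W" "inc G h' \<notin> W"
proof -
  have "(x, y) \<in> (adjacency G)\<^sup>*" using assms by (simp add: connected_def)
  then have "\<exists>(a, b) \<in> adjacency G. a \<in> W \<and> b \<notin> W"
    using assms(3,5) by (induction rule: rtrancl_induct) auto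
  then show ?thesis using that by (auto simp: adjacency_def)
qed

context graph
begin

lemma loopless_partner:
  assumes "loopless G" "h \<in> halfs G"
  shows "inc G (partner G h) \<noteq> inc G h"
proof
  assume eq: "inc G (partner G h) = inc G h"
  have "inj_on (inc G) {h, partner G h}"
    using assms edge_of_in_edges halfs_of_edge_of unfolding loopless_def by metis
  then show False using eq partner_neq[OF assms(2)] by auto
qed

text \<open>
  The end of a bridge inside \<open>W\<close> is a cut vertex, unless it is all of \<open>W\<close>; in that case all its
  three edges leave \<open>W\<close>.
\<close>

lemma two_connected_bridgeless:
  assumes two: "two_connected G" and cubic: "cubic G" and W: "W \<subseteq> verts G"
    and bridge: "{h \<in> halfs G. inc G h \<in> W \<and> inc G (partner G h) \<notin> W} \<subseteq> {h0}"
  shows "W = {} \<or> W = verts G"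
proof (rule ccontr)
  assume "\<not> ?thesis"
  then obtain a b where ab: "a \<in> W" "b \<in> verts G" "b \<notin> W" using W by blast
  have conn: "connected G" and loopless: "loopless G" using two by (auto simp: two_connected_def)
  obtain h h' where h: "h \<in> halfs G" "h' \<in> halfs G" "h \<noteq> h'" "edge_of G h = edge_of G h'"
    "inc G h \<in> W" "inc G h' \<notin> W"
    using connected_crossing[OF conn _ ab] W ab(1) by blast
  then have "h' = partner G h" using partner_unique[of h h'] by simp
  then have h0: "h = h0" using bridge h by blast
  let ?u = "inc G h"
  show False
  proof (cases "W = {?u}")
    case True
    have "halfs_at G ?u \<subseteq> {h0}"
    proof
      fix k assume "k \<in> halfs_at G ?u"
      then have k: "k \<in> halfs G" "inc G k = ?u" by (auto simp: halfs_at_def)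
      then have "inc G (partner G k) \<notin> W" using loopless_partner[OF loopless, of k] True by simp
      then show "k \<in> {h0}" using bridge k h(5) by auto
    qed
    then have "card (halfs_at G ?u) \<le> card {h0}" by (intro card_mono) auto
    then show False using cubic inc_in_verts[OF h(1)] by (auto simp: cubic_def)
  next
    case False
    then obtain x where x: "x \<in> W" "x \<noteq> ?u" using h(5) by blast
    let ?G = "delete_vertex G ?u"
    have "connected ?G" using two inc_in_verts[OF h(1)] by (auto simp: two_connected_def)
    moreover have "x \<in> verts ?G" "inc G h' \<in> verts ?G"
      using x W h inc_in_verts[OF h(2)] by (auto simp: delete_vertex_def Let_def)
    ultimately obtain k k' where k: "k \<in> halfs ?G" "k' \<in> halfs ?G" "k \<noteq> k'"
      "edge_of ?G k = edge_of ?G k'" "inc ?G k \<in> W" "inc ?G k' \<notin> W"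
      using connected_crossing[of ?G x W "inc G h'"] x h by blast
    have kG: "k \<in> halfs G" "k' \<in> halfs G" "edge_of G k = edge_of G k'" "inc G k \<in> W"
      "inc G k' \<notin> W" "inc G k \<noteq> ?u"
      using k by (auto simp: delete_vertex_def Let_def halfs_of_def)
    then have "k' = partner G k" using partner_unique[of k k'] k(3) by simp
    then have "k = h0" using bridge kG by blast
    then show False using h0 kG by simp
  qed
qed

end

section \<open>Residues modulo 3 and the final lift\<close>

lemma Z3_cases: "(x :: Z3) = 0 \<or> x = 1 \<or> x = -1"
proof -
  have "{0, 1, -1} = (UNIV :: Z3 set)" by (rule card_subset_eq) auto
  then show ?thesis using UNIV_I[of x] by blast
qed

lemma three_Z3: "(3 :: Z3) = 0"
  by simp

lemma of_int_Z3_eq_0: "(of_int z :: Z3) = 0 \<Longrightarrow> 3 dvd z"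
proof -
  assume z: "(of_int z :: Z3) = 0"
  have "(of_int z :: Z3) = of_int (3 * (z div 3) + z mod 3)" by simp
  also have "\<dots> = 3 * of_int (z div 3) + of_int (z mod 3)" by (simp only: of_int_add of_int_mult of_int_numeral)
  also have "\<dots> = of_int (z mod 3)" by (simp only: three_Z3 mult_zero_left add_0)
  finally have "(of_int (z mod 3) :: Z3) = 0" using z by simp
  moreover have "z mod 3 = 0 \<or> z mod 3 = 1 \<or> z mod 3 = 2" by presburger
  ultimately show "3 dvd z" by auto
qed

text \<open>The value at 0 is 1, so that multiplying an orientation by it always gives a sign, also
  off the support.\<close>

definition Z3_sign :: "Z3 \<Rightarrow> int" where
  "Z3_sign x = (if x = -1 then -1 else 1)"

lemma of_int_Z3_sign: "of_int (Z3_sign x * of_bool (x \<noteq> 0)) = x"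
  using Z3_cases[of x] by (auto simp: Z3_sign_def)

theorem theorem5:
  fixes G :: "('v, 'e, 'h) half_edge_graph"
    and \<sigma> :: "'e \<Rightarrow> int" and \<tau> :: "'h \<Rightarrow> int" and \<phi> :: "'e \<Rightarrow> Z3"
  assumes "bidirected_graph G \<sigma> \<tau>"
    and "two_connected G"
    and "cubic G"
    and "flow G \<tau> \<phi>"
  shows "\<exists>\<psi> :: 'e \<Rightarrow> int. k_flow 4 G \<tau> \<psi> \<and> (\<forall>e \<in> edges G. of_int (\<psi> e) = \<phi> e)"
proof -
  interpret bidirected_graph G \<sigma> \<tau> by (rule assms(1))
  define supp where "supp h \<longleftrightarrow> \<phi> (edge_of G h) \<noteq> 0" for h
  \<comment> \<open>Reversing the edges of value \<open>-1\<close> is absorbed into the orientation;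
    the lifted flow then has values 0 and 1.\<close>
  define t where "t h = \<tau> h * Z3_sign (\<phi> (edge_of G h))" for h
  have \<tau>: "\<tau> h = 1 \<or> \<tau> h = -1" if "h \<in> halfs G" for h using orientation_sign[OF that] by auto
  interpret cov: sign_cover "halfs G" "partner G" "inc G" "verts G" supp t
  proof
    show "3 dvd (\<Sum>h | h \<in> halfs G \<and> inc G h = v. t h * of_bool (supp h))" if "v \<in> verts G" for v
    proof (rule of_int_Z3_eq_0)
      have "(of_int (\<Sum>h | h \<in> halfs G \<and> inc G h = v. t h * of_bool (supp h)) :: Z3) = boundary G \<tau> \<phi> v"
        unfolding boundary_def halfs_at_def of_int_sum
      proof (intro sum.cong refl)
        fix h assume "h \<in> {h \<in> halfs G. inc G h = v}"
        then have "\<tau> h = 1 \<or> \<tau> h = -1" using \<tau> by blast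
        then show "of_int (t h * of_bool (supp h)) =
            (if \<tau> h = 1 then \<phi> (edge_of G h) else - \<phi> (edge_of G h))"
          using of_int_Z3_sign[of "\<phi> (edge_of G h)"] unfolding t_def supp_def
          by (auto simp del: of_int_mult simp: of_int_minus[symmetric])
      qed
      also have "\<dots> = 0" using assms(4) that by (simp add: flow_def)
      finally show "(of_int (\<Sum>h | h \<in> halfs G \<and> inc G h = v. t h * of_bool (supp h)) :: Z3) = 0" .
    qed
    show "card {h \<in> halfs G. inc G h = v} = 3" if "v \<in> verts G" for v
      using assms(3) that by (simp add: cubic_def halfs_at_def)
    show "inc G (partner G h) \<noteq> inc G h" if "h \<in> halfs G" for h
      using loopless_partner that assms(2) by (simp add: two_connected_def)
    show "t h = 1 \<or> t h = -1" if "h \<in> halfs G" for h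
      using \<tau>[OF that] by (auto simp: t_def Z3_sign_def)
  qed (use finite_halfs finite_verts inc_in_verts partner_in_halfs partner_partner partner_neq
      edge_of_partner two_connected_bridgeless[OF assms(2,3)] in \<open>auto simp: supp_def\<close>)
  obtain y where y: "\<And>h. h \<in> halfs G \<Longrightarrow> y (partner G h) = y h"
    "\<And>h. h \<in> halfs G \<Longrightarrow> y h \<in> (if supp h then {0, 1} else {-1, 0, 1})"
    "\<And>v. v \<in> verts G \<Longrightarrow>
      (\<Sum>h | h \<in> halfs G \<and> inc G h = v. t h * (of_bool (supp h) - 3 * y h)) = 0"
    by (rule cov.integral_correction) blast
  \<comment> \<open>The correction \<open>y\<close> lives on half-edges but agrees on the two halves
    of an edge, so any representative transfers it to edges.\<close>
  define rep where "rep e = (SOME h. h \<in> halfs_of G e)" for e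
  have rep: "rep e \<in> halfs G" "edge_of G (rep e) = e" if "e \<in> edges G" for e
  proof -
    have "halfs_of G e \<noteq> {}" using two_halfs[OF that] by auto
    then have "rep e \<in> halfs_of G e" unfolding rep_def by (rule some_in_eq[THEN iffD2])
    then show "rep e \<in> halfs G" "edge_of G (rep e) = e" by (auto simp: halfs_of_def)
  qed
  have y_rep: "y (rep (edge_of G h)) = y h" if "h \<in> halfs G" for h
    using rep[OF edge_of_in_edges[OF that]] partner_unique[OF that] y(1)[OF that] by metis
  \<comment> \<open>The sign undoes the reversal. Up to sign, the values are 1 or \<open>-2\<close>
    on the support and a multiple of 3 between \<open>-3\<close> and 3 off it.\<close>
  define \<psi> where "\<psi> e = Z3_sign (\<phi> e) * (of_bool (\<phi> e \<noteq> 0) - 3 * y (rep e))" for e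
  have "\<psi> e \<in> {-3..3} \<and> of_int (\<psi> e) = \<phi> e" if e: "e \<in> edges G" for e
  proof
    have "y (rep e) \<in> (if \<phi> e \<noteq> 0 then {0, 1} else {-1, 0, 1})"
      using y(2)[OF rep(1)[OF e]] rep(2)[OF e] by (simp add: supp_def)
    then show "\<psi> e \<in> {-3..3}" by (auto simp: \<psi>_def Z3_sign_def split: if_splits)
    have "of_int (\<psi> e) = (of_int (Z3_sign (\<phi> e) * of_bool (\<phi> e \<noteq> 0)) :: Z3)
        - 3 * of_int (Z3_sign (\<phi> e) * y (rep e))"
      by (simp add: \<psi>_def algebra_simps)
    then show "of_int (\<psi> e) = \<phi> e"
      by (simp only: of_int_Z3_sign three_Z3 mult_zero_left diff_zero)
  qed
  moreover have "flow G \<tau> \<psi>"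
    unfolding flow_def
  proof
    fix v assume v: "v \<in> verts G"
    have "boundary G \<tau> \<psi> v = (\<Sum>h | h \<in> halfs G \<and> inc G h = v. t h * (of_bool (supp h) - 3 * y h))"
      unfolding boundary_def halfs_at_def
    proof (intro sum.cong refl)
      fix h assume "h \<in> {h \<in> halfs G. inc G h = v}"
      then have "h \<in> halfs G" by simp
      then show "(if \<tau> h = 1 then \<psi> (edge_of G h) else - \<psi> (edge_of G h)) =
          t h * (of_bool (supp h) - 3 * y h)"
        using \<tau>[of h] y_rep[of h] by (auto simp: \<psi>_def t_def supp_def)
    qed
    then show "boundary G \<tau> \<psi> v = 0" using y(3)[OF v] by simp
  qed
  ultimately show ?thesis by (intro exI[of _ \<psi>]) (auto simp: k_flow_def)
qed

end
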